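(* Let $(H_3,g)$ be the Heisenberg manifold, let $\omega=dx^3+x^2dx^1-x^1dx^2$ be its contact form, and let $\omega^H$ and $\omega^V$ be the horizontal and the vertical lift of $\omega$ to $TH_3$. Then the distribution of codimension $1$ on $(TH_3,g^s)$ given by $F=\ker(\omega^H)$ is not totally geodesic, and likewise the distribution of codimension $1$ on $(TH_3,g^s)$ given by $F=\ker(\omega^V)$ is not totally geodesic.
   Context: The Heisenberg manifold $(H_3,g)$ is $\mathbb{R}^3$ with coordinates $(x^1,x^2,x^3)$ and metric $g=(dx^1)^2+(dx^2)^2+(dx^3+x^2dx^1-x^1dx^2)^2$. An orthonormal frame is $E_1=\frac{\partial}{\partial x^1}-x^2\frac{\partial}{\partial x^3}$, $E_2=\frac{\partial}{\partial x^2}+x^1\frac{\partial}{\partial x^3}$, $E_3=\frac{\partial}{\partial x^3}$. Let $\tau:TH_3\to H_3$ be the tangent bundle, with induced coordinates $(x^1,x^2,x^3,y^1,y^2,y^3)$, where $y^i$ are the components of a tangent vector $y^i\frac{\partial}{\partial x^i}$. For a vector field $X=X^i\frac{\partial}{\partial x^i}$ on $H_3$, the vertical lift is $X^V=X^i\frac{\partial}{\partial y^i}$ and the horizontal lift is $X^H=X^i\frac{\delta}{\delta x^i}$, where $\frac{\delta}{\delta x^j}=\frac{\partial}{\partial x^j}-y^k\Gamma^h_{kj}\frac{\partial}{\partial y^h}$ and $\Gamma^h_{kj}$ are the Christoffel symbols of $g$. The Sasaki metric $g^s$ on $TH_3$ is defined by $g^s(X^H,Y^H)=g^s(X^V,Y^V)=g(X,Y)\circ\tau$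 and $g^s(X^H,Y^V)=g^s(X^V,Y^H)=0$. The lifts of the $1$-form $\omega$ are the $1$-forms on $TH_3$ determined by $\omega^H(X^H)=\omega(X)\circ\tau$, $\omega^H(X^V)=0$ and $\omega^V(X^H)=0$, $\omega^V(X^V)=\omega(X)\circ\tau$ for all vector fields $X$ on $H_3$. Thus $\ker(\omega^H)$ is spanned by $E_1^H,E_2^H,E_1^V,E_2^V,E_3^V$, and $\ker(\omega^V)$ is spanned by $E_1^H,E_2^H,E_3^H,E_1^V,E_2^V$. A distribution $F$ on a Riemannian manifold is called totally geodesic if every geodesic which is tangent to $F$ at one point is tangent to $F$ at all of its points. *)

theory Defs
  imports "HOL-Analysis.Analysis"
begin

section \<open>Riemannian metrics in global coordinates\<close>

text \<open>
  All manifolds here are \<open>\<real>\<^sup>m\<close> with their global coordinates, so tangent vectors at every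
  point are elements of \<open>real^'m\<close>, given by their components with respect to the coordinate
  vector fields.
\<close>

type_synonym 'm metric = "real^'m \<Rightarrow> real^'m \<Rightarrow> real^'m \<Rightarrow> real"
type_synonym 'm oneform = "real^'m \<Rightarrow> real^'m \<Rightarrow> real"
type_synonym 'm vfield = "real^'m \<Rightarrow> real^'m"
type_synonym 'm distribution = "real^'m \<Rightarrow> (real^'m) set"

definition metric_matrix :: "'m::finite metric \<Rightarrow> real^'m \<Rightarrow> real^'m^'m" where
  "metric_matrix g x = (\<chi> i j. g x (axis i 1) (axis j 1))"

definition partial :: "'m::finite \<Rightarrow> (real^'m \<Rightarrow> real) \<Rightarrow> real^'m \<Rightarrow> real" where
  "partial i f x = deriv (\<lambda>t. f (x + t *\<^sub>R axis i 1)) 0"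

text \<open>\<open>christoffel g h k j x\<close> is \<open>\<Gamma>\<^sup>h\<^sub>k\<^sub>j\<close> at \<open>x\<close>.\<close>

definition christoffel :: "'m::finite metric \<Rightarrow> 'm \<Rightarrow> 'm \<Rightarrow> 'm \<Rightarrow> real^'m \<Rightarrow> real" where
  "christoffel g h k j x =
     (1/2) * (\<Sum>l\<in>UNIV. matrix_inv (metric_matrix g x) $ h $ l *
        (partial k (\<lambda>z. metric_matrix g z $ l $ j) x
         + partial j (\<lambda>z. metric_matrix g z $ l $ k) x
         - partial l (\<lambda>z. metric_matrix g z $ k $ j) x))"

definition velocity :: "(real \<Rightarrow> real^'m::finite) \<Rightarrow> real \<Rightarrow> real^'m" where
  "velocity c t = vector_derivative c (at t)"

text \<open>
  Geodesics are parametrised on an arbitrary open interval and need not be maximal. For a smooth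
  metric, twice differentiable solutions of the geodesic equation are automatically smooth.
\<close>

definition geodesic :: "'m::finite metric \<Rightarrow> real set \<Rightarrow> (real \<Rightarrow> real^'m) \<Rightarrow> bool" where
  "geodesic g I c \<longleftrightarrow>
     open I \<and> is_interval I \<and>
     (\<forall>t\<in>I. c differentiable (at t) \<and> velocity c differentiable (at t) \<and>
        (\<forall>h. vector_derivative (velocity c) (at t) $ h
             + (\<Sum>k\<in>UNIV. \<Sum>j\<in>UNIV.
                  christoffel g h k j (c t) * velocity c t $ k * velocity c t $ j) = 0))"

definition totally_geodesic :: "'m::finite metric \<Rightarrow> 'm distribution \<Rightarrow> bool" where
  "totally_geodesic g F \<longleftrightarrow>
     (\<forall>I c. geodesic g I c \<longrightarrow>
        (\<exists>t\<in>I. velocity c t \<in> F (c t)) \<longrightarrow> (\<forall>t\<in>I. velocity c t \<in> F (c t)))"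

definition ker_oneform :: "'m::finite oneform \<Rightarrow> 'm distribution" where
  "ker_oneform \<alpha> p = {v. \<alpha> p v = 0}"


section \<open>The tangent bundle\<close>

text \<open>
  The total space of the tangent bundle of \<open>\<real>\<^sup>n\<close> is \<open>real^('n + 'n)\<close>: the coordinate \<open>x\<^sup>i\<close> has
  index \<open>Inl i\<close> and \<open>y\<^sup>i\<close> has index \<open>Inr i\<close>. Applied to a point, \<open>base\<close> is the bundle projection
  \<open>\<tau>\<close>; applied to a tangent vector of the total space, it is the differential of \<open>\<tau>\<close>.
\<close>

definition base :: "real^('n::finite + 'n) \<Rightarrow> real^'n" where
  "base p = (\<chi> i. p $ Inl i)"

definition fibre :: "real^('n::finite + 'n) \<Rightarrow> real^'n" where
  "fibre p = (\<chi> i. p $ Inr i)"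

definition vlift :: "'n::finite vfield \<Rightarrow> ('n + 'n) vfield" where
  "vlift X p = (\<Sum>i\<in>UNIV. X (base p) $ i *\<^sub>R axis (Inr i) 1)"

text \<open>The vector field \<open>\<delta>/\<delta>x\<^sup>j\<close>:\<close>

definition hframe :: "'n::finite metric \<Rightarrow> 'n \<Rightarrow> ('n + 'n) vfield" where
  "hframe g j p = axis (Inl j) 1
     - (\<Sum>k\<in>UNIV. \<Sum>h\<in>UNIV.
          (fibre p $ k * christoffel g h k j (base p)) *\<^sub>R axis (Inr h) 1)"

definition hlift :: "'n::finite metric \<Rightarrow> 'n vfield \<Rightarrow> ('n + 'n) vfield" where
  "hlift g X p = (\<Sum>i\<in>UNIV. X (base p) $ i *\<^sub>R hframe g i p)"

text \<open>
  The Sasaki metric and the lifts of a 1-form are the unique objects with the listed values on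
  lifts. The values of the lifts of \<open>X\<close> at \<open>p\<close> depend only on \<open>X (base p)\<close>, so it makes no
  difference that \<open>X\<close> and \<open>Y\<close> range over all vector fields, not only the smooth ones.
\<close>

definition is_sasaki :: "'n::finite metric \<Rightarrow> ('n + 'n) metric \<Rightarrow> bool" where
  "is_sasaki g G \<longleftrightarrow>
     (\<forall>p. bilinear (G p)) \<and>
     (\<forall>X Y p. G p (hlift g X p) (hlift g Y p) = g (base p) (X (base p)) (Y (base p)) \<and>
              G p (vlift X p) (vlift Y p) = g (base p) (X (base p)) (Y (base p)) \<and>
              G p (hlift g X p) (vlift Y p) = 0 \<and>
              G p (vlift X p) (hlift g Y p) = 0)"

definition sasaki :: "'n::finite metric \<Rightarrow> ('n + 'n) metric" where
  "sasaki g = (THE G. is_sasaki g G)"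

definition is_oneform_hlift :: "'n::finite metric \<Rightarrow> 'n oneform \<Rightarrow> ('n + 'n) oneform \<Rightarrow> bool" where
  "is_oneform_hlift g \<alpha> \<beta> \<longleftrightarrow>
     (\<forall>p. linear (\<beta> p)) \<and>
     (\<forall>X p. \<beta> p (hlift g X p) = \<alpha> (base p) (X (base p)) \<and> \<beta> p (vlift X p) = 0)"

definition oneform_hlift :: "'n::finite metric \<Rightarrow> 'n oneform \<Rightarrow> ('n + 'n) oneform" where
  "oneform_hlift g \<alpha> = (THE \<beta>. is_oneform_hlift g \<alpha> \<beta>)"

definition is_oneform_vlift :: "'n::finite metric \<Rightarrow> 'n oneform \<Rightarrow> ('n + 'n) oneform \<Rightarrow> bool" where
  "is_oneform_vlift g \<alpha> \<beta> \<longleftrightarrow>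
     (\<forall>p. linear (\<beta> p)) \<and>
     (\<forall>X p. \<beta> p (hlift g X p) = 0 \<and> \<beta> p (vlift X p) = \<alpha> (base p) (X (base p)))"

definition oneform_vlift :: "'n::finite metric \<Rightarrow> 'n oneform \<Rightarrow> ('n + 'n) oneform" where
  "oneform_vlift g \<alpha> = (THE \<beta>. is_oneform_vlift g \<alpha> \<beta>)"


subsection \<open>Existence and uniqueness of the lifts\<close>

text \<open>The connection map, that is, the vertical component of a tangent vector \<open>w\<close> at \<open>p\<close>.\<close>

definition conn :: "'n::finite metric \<Rightarrow> real^('n + 'n) \<Rightarrow> real^('n + 'n) \<Rightarrow> real^'n" where
  "conn g p w = (\<chi> h. w $ Inr h
     + (\<Sum>k\<in>UNIV. \<Sum>j\<in>UNIV. fibre p $ k * christoffel g h k j (base p) * w $ Inl j))"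

lemma vlift_nth [simp]:
  "vlift X p $ Inl i = 0" "vlift X p $ Inr i = X (base p) $ i"
  by (simp_all add: vlift_def axis_def if_distrib sum.delta' cong: if_cong)

lemma hframe_nth:
  "hframe g j p $ Inl i = (if i = j then 1 else 0)"
  "hframe g j p $ Inr i = - (\<Sum>k\<in>UNIV. fibre p $ k * christoffel g i k j (base p))"
  by (simp_all add: hframe_def axis_def if_distrib sum.delta' cong: if_cong)

lemma hlift_nth [simp]:
  "hlift g X p $ Inl i = X (base p) $ i"
  "hlift g X p $ Inr i =
     - (\<Sum>k\<in>UNIV. \<Sum>j\<in>UNIV. fibre p $ k * christoffel g i k j (base p) * X (base p) $ j)"
proof -
  show "hlift g X p $ Inl i = X (base p) $ i"
    by (simp add: hlift_def hframe_nth if_distrib cong: if_cong)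
  have "hlift g X p $ Inr i =
      - (\<Sum>j\<in>UNIV. \<Sum>k\<in>UNIV. X (base p) $ j * (fibre p $ k * christoffel g i k j (base p)))"
    by (simp add: hlift_def hframe_nth sum_negf sum_distrib_left)
  also have "\<dots> =
      - (\<Sum>k\<in>UNIV. \<Sum>j\<in>UNIV. fibre p $ k * christoffel g i k j (base p) * X (base p) $ j)"
    by (subst sum.swap) (simp add: mult_ac)
  finally show "hlift g X p $ Inr i = \<dots>" .
qed

lemma base_conn_lift [simp]:
  "base (hlift g X p) = X (base p)" "conn g p (hlift g X p) = 0"
  "base (vlift X p) = 0" "conn g p (vlift X p) = X (base p)"
  by (simp_all add: base_def conn_def vec_eq_iff)

lemma linear_base: "linear base"
  by (rule linearI) (simp_all add: base_def vec_eq_iff)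

lemma linear_conn: "linear (conn g p)"
  by (rule linearI)
    (simp_all add: conn_def vec_eq_iff algebra_simps sum.distrib sum_distrib_left)

lemma decompose: "w = hlift g (\<lambda>_. base w) p + vlift (\<lambda>_. conn g p w) p"
proof -
  have "w $ i = (hlift g (\<lambda>_. base w) p + vlift (\<lambda>_. conn g p w) p) $ i" for i
    by (cases i) (simp_all add: base_def conn_def)
  then show ?thesis
    by (simp add: vec_eq_iff)
qed

lemma sasaki_unique:
  assumes "is_sasaki g G"
  shows "G = (\<lambda>p v w. g (base p) (base v) (base w) + g (base p) (conn g p v) (conn g p w))"
proof (intro ext)
  fix p v w
  have "bilinear (G p)"
    using assms by (simp add: is_sasaki_def)
  then have "G p (hlift g (\<lambda>_. base v) p + vlift (\<lambda>_. conn g p v) p)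
          (hlift g (\<lambda>_. base w) p + vlift (\<lambda>_. conn g p w) p) =
        g (base p) (base v) (base w) + g (base p) (conn g p v) (conn g p w)"
    using assms by (simp add: bilinear_ladd bilinear_radd is_sasaki_def)
  then show "G p v w = g (base p) (base v) (base w) + g (base p) (conn g p v) (conn g p w)"
    by (simp flip: decompose)
qed

lemma is_sasaki_ex:
  assumes "\<And>x. bilinear (g x)"
  shows "is_sasaki g
     (\<lambda>p v w. g (base p) (base v) (base w) + g (base p) (conn g p v) (conn g p w))"
proof -
  have "bilinear (\<lambda>v w. g (base p) (base v) (base w) + g (base p) (conn g p v) (conn g p w))" for p
    using assms[of "base p"] unfolding bilinear_def
    by (auto intro!: linear_compose_add
        linear_compose[OF linear_base, unfolded o_def]
        linear_compose[OF linear_conn, unfolded o_def])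
  then show ?thesis
    by (simp add: is_sasaki_def bilinear_lzero[OF assms] bilinear_rzero[OF assms])
qed

lemma sasaki_eq:
  assumes "\<And>x. bilinear (g x)"
  shows "sasaki g =
     (\<lambda>p v w. g (base p) (base v) (base w) + g (base p) (conn g p v) (conn g p w))"
  unfolding sasaki_def
  by (rule the_equality) (fact is_sasaki_ex[OF assms], fact sasaki_unique)

lemma oneform_hlift_eq:
  assumes "\<And>x. linear (\<alpha> x)"
  shows "oneform_hlift g \<alpha> = (\<lambda>p w. \<alpha> (base p) (base w))"
  unfolding oneform_hlift_def
proof (rule the_equality)
  show "is_oneform_hlift g \<alpha> (\<lambda>p w. \<alpha> (base p) (base w))"
    using linear_compose[OF linear_base assms, unfolded o_def]
    by (simp add: is_oneform_hlift_def linear_0[OF assms])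
next
  fix \<beta> assume \<beta>: "is_oneform_hlift g \<alpha> \<beta>"
  show "\<beta> = (\<lambda>p w. \<alpha> (base p) (base w))"
  proof (intro ext)
    fix p w
    have "\<beta> p (hlift g (\<lambda>_. base w) p + vlift (\<lambda>_. conn g p w) p) = \<alpha> (base p) (base w)"
      using \<beta> by (simp add: is_oneform_hlift_def linear_add)
    then show "\<beta> p w = \<alpha> (base p) (base w)"
      by (simp flip: decompose)
  qed
qed

lemma oneform_vlift_eq:
  assumes "\<And>x. linear (\<alpha> x)"
  shows "oneform_vlift g \<alpha> = (\<lambda>p w. \<alpha> (base p) (conn g p w))"
  unfolding oneform_vlift_def
proof (rule the_equality)
  show "is_oneform_vlift g \<alpha> (\<lambda>p w. \<alpha> (base p) (conn g p w))"
    using linear_compose[OF linear_conn assms, unfolded o_def]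
    by (simp add: is_oneform_vlift_def linear_0[OF assms])
next
  fix \<beta> assume \<beta>: "is_oneform_vlift g \<alpha> \<beta>"
  show "\<beta> = (\<lambda>p w. \<alpha> (base p) (conn g p w))"
  proof (intro ext)
    fix p w
    have "\<beta> p (hlift g (\<lambda>_. base w) p + vlift (\<lambda>_. conn g p w) p) = \<alpha> (base p) (conn g p w)"
      using \<beta> by (simp add: is_oneform_vlift_def linear_add)
    then show "\<beta> p w = \<alpha> (base p) (conn g p w)"
      by (simp flip: decompose)
  qed
qed


section \<open>The Heisenberg manifold\<close>

definition heis_form :: "3 oneform" where
  "heis_form x v = v $ 3 + x $ 2 * v $ 1 - x $ 1 * v $ 2"

definition heis_metric :: "3 metric" where
  "heis_metric x u v = u $ 1 * v $ 1 + u $ 2 * v $ 2 + heis_form x u * heis_form x v"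

lemma linear_heis_form: "linear (heis_form x)"
  by (rule linearI) (simp_all add: heis_form_def algebra_simps)

lemma bilinear_heis_metric: "bilinear (heis_metric x)"
  unfolding bilinear_def
  by (auto intro!: linearI simp: heis_metric_def heis_form_def algebra_simps)

lemmas heis_sasaki_eq = sasaki_eq[of heis_metric, OF bilinear_heis_metric]
lemmas heis_hlift_eq = oneform_hlift_eq[of heis_form, OF linear_heis_form]
lemmas heis_vlift_eq = oneform_vlift_eq[of heis_form, OF linear_heis_form]

text \<open>Both kernels are hyperplane fields, that is, distributions of codimension 1.\<close>

lemma dim_kernel_functional:
  fixes f :: "real^'m::finite \<Rightarrow> real"
  assumes "linear f" "f v \<noteq> 0"
  shows "subspace {w. f w = 0}" "dim {w. f w = 0} = CARD('m) - 1"
proof -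
  show "subspace {w. f w = 0}"
    using assms(1) by (rule linear_subspace_kernel)
  have *: "f w = adjoint f 1 \<bullet> w" for w
    using adjoint_works[OF assms(1), of w 1] by (simp add: inner_commute)
  have "adjoint f 1 \<noteq> 0"
    using assms(2) * by (metis inner_zero_left)
  then show "dim {w. f w = 0} = CARD('m) - 1"
    by (simp add: * dim_hyperplane)
qed

lemma codim_ker_hlift:
  "subspace (ker_oneform (oneform_hlift heis_metric heis_form) p)"
  "dim (ker_oneform (oneform_hlift heis_metric heis_form) p) = 5"
proof -
  let ?f = "\<lambda>w. heis_form (base p) (base w)"
  have lin: "linear ?f"
    using linear_compose[OF linear_base linear_heis_form, unfolded o_def] .
  have nz: "?f (hlift heis_metric (\<lambda>_. axis 3 1) p) \<noteq> 0"
    by (simp add: heis_form_def axis_def)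
  show "subspace (ker_oneform (oneform_hlift heis_metric heis_form) p)"
    "dim (ker_oneform (oneform_hlift heis_metric heis_form) p) = 5"
    using dim_kernel_functional[OF lin nz] by (simp_all add: ker_oneform_def heis_hlift_eq)
qed

lemma codim_ker_vlift:
  "subspace (ker_oneform (oneform_vlift heis_metric heis_form) p)"
  "dim (ker_oneform (oneform_vlift heis_metric heis_form) p) = 5"
proof -
  let ?f = "\<lambda>w. heis_form (base p) (conn heis_metric p w)"
  have lin: "linear ?f"
    using linear_compose[OF linear_conn linear_heis_form, unfolded o_def] .
  have nz: "?f (vlift (\<lambda>_. axis 3 1) p) \<noteq> 0"
    by (simp add: heis_form_def axis_def)
  show "subspace (ker_oneform (oneform_vlift heis_metric heis_form) p)"
    "dim (ker_oneform (oneform_vlift heis_metric heis_form) p) = 5"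
    using dim_kernel_functional[OF lin nz] by (simp_all add: ker_oneform_def heis_vlift_eq)
qed

end

theory Submission
  imports Defs
begin

text \<open>
  A single explicit geodesic refutes both claims. A curve in \<open>TH\<^sub>3\<close> is a curve \<open>x\<close> with a
  vector field \<open>y\<close> along it, and it is a Sasaki geodesic iff \<open>Z = \<nabla>\<^bsub>x'\<^esub> y\<close> is parallel and
  \<open>\<nabla>\<^bsub>x'\<^esub> x' = -R(y, Z)x'\<close>. The curvature term only depends on \<open>W = y \<times> Z\<close>, which is again parallel.
  In the left-invariant frame \<open>E\<^sub>1, E\<^sub>2, E\<^sub>3\<close> the system for \<open>(x', W)\<close> conserves \<open>x'\<^sub>3 - W\<^sub>3\<close>,
  and when this constant is \<open>0\<close> also \<open>x'\<^sub>1 + W\<^sub>1\<close> and \<open>x'\<^sub>2 + W\<^sub>2\<close>, so that it becomes linear.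
  The solution \<open>x' = (1, cos t, sin t)\<close>, \<open>W = (0, -cos t, sin t)\<close> gives
  \<open>Z = (cos t, sin\<^sup>2 t, sin t cos t)\<close> and \<open>y = t Z + (sin t, -sin t cos t, -cos\<^sup>2 t)\<close>. Hence
  \<open>\<omega>(x') = sin t\<close> and \<open>\<omega>(Z) = sin t cos t\<close> both vanish at \<open>0\<close> but not identically.
\<close>

section \<open>Linear algebra and differentiation in coordinates\<close>

lemma axis_expansion: "(\<Sum>i\<in>UNIV. u $ i *\<^sub>R axis i 1) = (u :: real^'m::finite)"
  by (simp add: vec_eq_iff axis_def if_distrib cong: if_cong)

text \<open>Serves to read the coordinate double sums of the geodesic equation as values of a
  bilinear form.\<close>

lemma bilinear_expand:
  fixes f :: "real^'m::finite \<Rightarrow> real^'m \<Rightarrow> real"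
  assumes "bilinear f"
  shows "(\<Sum>k\<in>UNIV. \<Sum>j\<in>UNIV. f (axis k 1) (axis j 1) * u $ k * w $ j) = f u w"
proof -
  have l: "linear (\<lambda>u. f u w)" "linear (\<lambda>w. f u w)" for u w
    using assms by (auto simp: bilinear_def)
  have "f u w = f (\<Sum>k\<in>UNIV. u $ k *\<^sub>R axis k 1) (\<Sum>j\<in>UNIV. w $ j *\<^sub>R axis j 1)"
    by (simp add: axis_expansion)
  also have "\<dots> = (\<Sum>k\<in>UNIV. \<Sum>j\<in>UNIV. f (axis k 1) (axis j 1) * u $ k * w $ j)"
    unfolding linear_sum[OF l(1)]
    by (simp add: linear_sum[OF l(2)] linear_cmul[OF l(1)] linear_cmul[OF l(2)]
        sum_distrib_left mult_ac)
  finally show ?thesis ..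
qed

lemma partial_eq:
  assumes "(f has_derivative f') (at x)"
  shows "partial i f x = f' (axis i 1)"
proof -
  interpret f': bounded_linear f'
    using assms by (rule has_derivative_bounded_linear)
  have "((\<lambda>t. x + t *\<^sub>R axis i (1::real)) has_derivative (\<lambda>t. t *\<^sub>R axis i 1)) (at 0)"
    by (auto intro!: derivative_eq_intros)
  then have "((\<lambda>t. f (x + t *\<^sub>R axis i 1)) has_derivative (\<lambda>t. f' (t *\<^sub>R axis i 1))) (at 0)"
    by (rule has_derivative_compose) (simp add: assms)
  then have "((\<lambda>t. f (x + t *\<^sub>R axis i 1)) has_real_derivative f' (axis i 1)) (at 0)"
    by (rule has_derivative_imp_has_field_derivative) (simp add: f'.scaleR)
  then show ?thesis
    unfolding partial_def by (rule DERIV_imp_deriv)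
qed

lemma has_vector_derivative_vecI:
  fixes c :: "real \<Rightarrow> real^'m::finite"
  assumes "\<And>i. ((\<lambda>t. c t $ i) has_real_derivative c' $ i) (at t)"
  shows "(c has_vector_derivative c') (at t)"
  unfolding has_vector_derivative_def
proof (subst has_derivative_componentwise_within, intro ballI)
  fix b :: "real^'m" assume "b \<in> Basis"
  then obtain i where b: "b = axis i 1"
    by (auto simp: Basis_vec_def)
  show "((\<lambda>x. c x \<bullet> b) has_derivative (\<lambda>x. x *\<^sub>R c' \<bullet> b)) (at t)"
    using assms[of i] by (simp add: b inner_axis has_field_derivative_def mult_commute_abs)
qed

lemma matrix_inv_inverse:
  fixes A :: "real^'n::finite^'n"
  assumes "invertible A"
  shows "A ** matrix_inv A = mat 1" and "matrix_inv A ** A = mat 1"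
  using someI_ex[OF assms[unfolded invertible_def]] unfolding matrix_inv_def by auto

text \<open>A kernel vector \<open>u\<close> of the matrix satisfies \<open>g x u u = 0\<close>, so
  definiteness makes the kernel trivial.\<close>

lemma invertible_metric_matrix:
  assumes "bilinear (g x)" and "\<And>u. g x u u = 0 \<Longrightarrow> u = 0"
  shows "invertible (metric_matrix g x)"
proof -
  have "u = 0" if u: "metric_matrix g x *v u = 0" for u
  proof -
    have "g x u u = (\<Sum>k\<in>UNIV. u $ k * (metric_matrix g x *v u) $ k)"
      by (subst bilinear_expand[OF assms(1), symmetric])
        (simp add: metric_matrix_def matrix_vector_mult_def sum_distrib_left mult_ac)
    then show ?thesis
      using assms(2) u by simp
  qed
  then show ?thesis
    by (simp add: invertible_left_inverse matrix_left_invertible_ker)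
qed

section \<open>The geodesic equation in a coframe\<close>

text \<open>
  Lowering the index of the geodesic equation and writing \<open>g = \<Sum>\<^sub>a \<theta>\<^sub>a\<^sup>2\<close> turns it into
  \<open>\<Sum>\<^sub>a (\<theta>\<^sub>a(c'))' \<theta>\<^sub>a(w) + \<theta>\<^sub>a(c') d\<theta>\<^sub>a(c', w) = 0\<close> for all \<open>w\<close>, in which no inverse
  matrix occurs. Here \<open>D a x w u\<close> is the derivative of \<open>\<theta> a \<cdot> u\<close> at \<open>x\<close> in direction \<open>w\<close>.
\<close>

lemma geodesic_coframeI:
  fixes \<theta> :: "'a::finite \<Rightarrow> 'm::finite oneform"
  assumes g: "\<And>x u w. g x u w = (\<Sum>a\<in>UNIV. \<theta> a x u * \<theta> a x w)"
    and lin: "\<And>a x. linear (\<theta> a x)"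
    and inj: "\<And>x u. (\<And>a. \<theta> a x u = 0) \<Longrightarrow> u = 0"
    and deriv: "\<And>a x u. ((\<lambda>z. \<theta> a z u) has_derivative (\<lambda>w. D a x w u)) (at x)"
    and bil: "\<And>a x. bilinear (D a x)"
    and I: "open I" "is_interval I"
    and c: "\<And>t. t \<in> I \<Longrightarrow> (c has_vector_derivative v t) (at t)"
    and v: "\<And>t. t \<in> I \<Longrightarrow> (v has_vector_derivative v' t) (at t)"
    and eq: "\<And>t l. t \<in> I \<Longrightarrow>
      (\<Sum>a\<in>UNIV. (\<theta> a (c t) (v' t) + D a (c t) (v t) (v t)) * \<theta> a (c t) (axis l 1)
        + \<theta> a (c t) (v t) * (D a (c t) (v t) (axis l 1) - D a (c t) (axis l 1) (v t))) = 0"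
  shows "geodesic g I c"
proof -
  have bg: "bilinear (g x)" for x
    by (auto simp: bilinear_def g linear_iff linear_add[OF lin] linear_cmul[OF lin]
        algebra_simps sum.distrib sum_distrib_left)
  have bilD: "linear (\<lambda>u. D a x u w)" "linear (\<lambda>w. D a x u w)" for a x u w
    using bil[of a x] by (auto simp: bilinear_def)
  have inv: "invertible (metric_matrix g x)" for x
  proof (rule invertible_metric_matrix[OF bg])
    fix u assume "g x u u = 0"
    then have "\<theta> a x u = 0" for a
      by (simp add: g sum_nonneg_eq_0_iff)
    then show "u = 0" by (rule inj)
  qed
  define dg where "dg x w u u' = (\<Sum>a\<in>UNIV. D a x w u * \<theta> a x u' + \<theta> a x u * D a x w u')" for x w u u'
  have part: "partial k (\<lambda>z. metric_matrix g z $ i $ j) x = dg x (axis k 1) (axis i 1) (axis j 1)" for i j k x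
  proof -
    have "((\<lambda>z. g z (axis i 1) (axis j 1)) has_derivative (\<lambda>w. dg x w (axis i 1) (axis j 1))) (at x)"
      unfolding g dg_def
      by (rule has_derivative_sum) (auto intro!: derivative_eq_intros deriv)
    then show ?thesis
      by (simp add: metric_matrix_def partial_eq)
  qed
  have acc: "v' t $ h + (\<Sum>k\<in>UNIV. \<Sum>j\<in>UNIV. christoffel g h k j (c t) * v t $ k * v t $ j) = 0"
    if t: "t \<in> I" for t h
  proof -
    \<comment> \<open>Contracting the Christoffel symbols of the first kind with the velocity gives
      \<open>b\<close>; the geodesic equation becomes \<open>M *v v' t + b = 0\<close>.\<close>
    define M where "M = metric_matrix g (c t)"
    define b where "b = (\<chi> l. (\<Sum>k\<in>UNIV. \<Sum>j\<in>UNIV.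
      (1/2) * (partial k (\<lambda>z. metric_matrix g z $ l $ j) (c t)
         + partial j (\<lambda>z. metric_matrix g z $ l $ k) (c t)
         - partial l (\<lambda>z. metric_matrix g z $ k $ j) (c t)) * v t $ k * v t $ j))"
    have G: "(\<Sum>k\<in>UNIV. \<Sum>j\<in>UNIV. christoffel g h k j (c t) * v t $ k * v t $ j)
        = (matrix_inv M *v b) $ h"
    proof -
      have "(matrix_inv M *v b) $ h = (\<Sum>l\<in>UNIV. \<Sum>k\<in>UNIV. \<Sum>j\<in>UNIV. matrix_inv M $ h $ l *
       ((1/2) * (partial k (\<lambda>z. metric_matrix g z $ l $ j) (c t)
         + partial j (\<lambda>z. metric_matrix g z $ l $ k) (c t)
         - partial l (\<lambda>z. metric_matrix g z $ k $ j) (c t)) * v t $ k * v t $ j))"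
        by (simp add: matrix_vector_mult_def b_def sum_distrib_left)
      also have "\<dots> = (\<Sum>k\<in>UNIV. \<Sum>j\<in>UNIV. \<Sum>l\<in>UNIV. matrix_inv M $ h $ l *
       ((1/2) * (partial k (\<lambda>z. metric_matrix g z $ l $ j) (c t)
         + partial j (\<lambda>z. metric_matrix g z $ l $ k) (c t)
         - partial l (\<lambda>z. metric_matrix g z $ k $ j) (c t)) * v t $ k * v t $ j))"
        by (subst sum.swap, rule sum.cong[OF refl], subst sum.swap, rule refl)
      finally show ?thesis
        by (simp add: christoffel_def M_def sum_distrib_left sum_distrib_right mult_ac)
    qed
    have "(M *v v' t + b) $ l = 0" for l
    proof -
      have 1: "(M *v v' t) $ l = (\<Sum>a\<in>UNIV. \<theta> a (c t) (v' t) * \<theta> a (c t) (axis l 1))"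
      proof -
        have lg: "linear (g (c t) (axis l 1))"
          using bg by (auto simp: bilinear_def)
        have "(M *v v' t) $ l = (\<Sum>h\<in>UNIV. v' t $ h * g (c t) (axis l 1) (axis h 1))"
          by (simp add: matrix_vector_mult_def M_def metric_matrix_def mult_ac)
        also have "\<dots> = g (c t) (axis l 1) (\<Sum>h\<in>UNIV. v' t $ h *\<^sub>R axis h 1)"
          by (simp add: linear_sum[OF lg] linear_cmul[OF lg])
        finally show ?thesis
          by (simp add: axis_expansion g mult_ac)
      qed
      \<comment> \<open>The first-kind Christoffel symbols, extended bilinearly. On the diagonal the
        first two terms coincide, and the product rule in \<open>dg\<close> yields exactly the terms
        of \<open>eq\<close>.\<close>
      let ?f = "\<lambda>u w. (1/2) * (dg (c t) u (axis l 1) w + dg (c t) w (axis l 1) u - dg (c t) (axis l 1) u w)"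
      have "bilinear ?f"
        by (auto simp: bilinear_def dg_def linear_iff linear_add[OF lin] linear_cmul[OF lin]
            linear_add[OF bilD(1)] linear_cmul[OF bilD(1)] linear_add[OF bilD(2)] linear_cmul[OF bilD(2)]
            algebra_simps sum.distrib sum_distrib_left sum_subtractf
            add_divide_distrib diff_divide_distrib)
      then have "b $ l = ?f (v t) (v t)"
        by (subst bilinear_expand[symmetric]) (simp_all add: b_def part)
      then show ?thesis
        using eq[OF t, of l]
        by (simp add: 1 dg_def algebra_simps sum.distrib sum_subtractf flip: sum_distrib_left)
    qed
    then have "b = - (M *v v' t)"
      by (simp add: vec_eq_iff add_eq_0_iff)
    then have "matrix_inv M *v b = - v' t"
      using inv[of "c t"]
      by (simp add: M_def matrix_vector_mul_assoc matrix_inv_inverse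
          linear_neg[OF matrix_vector_mul_linear])
    then show ?thesis
      by (simp add: G)
  qed
  have vel: "velocity c t = v t" if "t \<in> I" for t
    using c[OF that] by (simp add: velocity_def vector_derivative_at)
  \<comment> \<open>\<open>velocity c\<close> agrees with \<open>v\<close> only on \<open>I\<close>;
    openness of \<open>I\<close> lets the derivative carry over.\<close>
  have "(velocity c has_vector_derivative v' t) (at t)" if "t \<in> I" for t
    using v[OF that] I(1) that by (rule has_vector_derivative_transform_within_open) (simp add: vel)
  then have "velocity c differentiable (at t)" "vector_derivative (velocity c) (at t) = v' t"
    if "t \<in> I" for t
    using that by (auto simp: vector_derivative_at intro: differentiableI_vector)
  moreover have "c differentiable (at t)" if "t \<in> I" for t
    using c[OF that] by (rule differentiableI_vector)
  ultimately show ?thesis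
    unfolding geodesic_def using I acc vel by simp
qed

section \<open>The connection of the Heisenberg metric\<close>

lemma sum_3_plus_3:
  "sum f (UNIV :: (3 + 3) set) =
    f (Inl 1) + f (Inl 2) + f (Inl 3) + f (Inr 1) + f (Inr 2) + f (Inr 3)"
  by (subst UNIV_Plus_UNIV[symmetric]) (simp add: sum.Plus sum_3 add.assoc del: UNIV_Plus_UNIV)

lemma forall_3_plus_3:
  "(\<forall>i :: 3 + 3. P i) \<longleftrightarrow>
    P (Inl 1) \<and> P (Inl 2) \<and> P (Inl 3) \<and> P (Inr 1) \<and> P (Inr 2) \<and> P (Inr 3)"
  by (simp add: split_sum_all forall_3)

lemma partial_heis_metric:
  "partial k (\<lambda>z. metric_matrix heis_metric z $ i $ j) x =
    (axis k 1 $ 2 * axis i 1 $ 1 - axis k 1 $ 1 * axis i 1 $ 2) * heis_form x (axis j 1)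
    + heis_form x (axis i 1) * (axis k 1 $ 2 * axis j 1 $ 1 - axis k 1 $ 1 * axis j 1 $ 2)"
proof -
  have nth: "((\<lambda>z::real^3. z $ a) has_derivative (\<lambda>w. w $ a)) (at x)" for a
    by (rule bounded_linear_imp_has_derivative) (rule bounded_linear_vec_nth)
  have form: "((\<lambda>z. heis_form z u) has_derivative (\<lambda>w. w $ 2 * u $ 1 - w $ 1 * u $ 2)) (at x)" for u
    unfolding heis_form_def by (auto intro!: derivative_eq_intros nth)
  have metric: "((\<lambda>z. heis_metric z u v) has_derivative (\<lambda>w. (w $ 2 * u $ 1 - w $ 1 * u $ 2) * heis_form x v
      + heis_form x u * (w $ 2 * v $ 1 - w $ 1 * v $ 2))) (at x)" for u v
    unfolding heis_metric_def by (auto intro!: derivative_eq_intros form)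
  show ?thesis
    using partial_eq[OF metric[of "axis i 1" "axis j 1"], of k] by (simp add: metric_matrix_def)
qed

text \<open>The inverse is the dual metric, the sum of \<open>E E^T\<close> over the orthonormal
  frame. For square matrices a right inverse suffices.\<close>

lemma matrix_inv_heis:
  "matrix_inv (metric_matrix heis_metric x) =
    vector [vector [1, 0, - x $ 2], vector [0, 1, x $ 1], vector [- x $ 2, x $ 1, 1 + (x $ 1)^2 + (x $ 2)^2]]"
  (is "matrix_inv ?A = ?B")
proof -
  have AB: "?A ** ?B = mat 1"
    by (simp add: vec_eq_iff forall_3 matrix_matrix_mult_def mat_def sum_3 metric_matrix_def
        heis_metric_def heis_form_def axis_def algebra_simps power2_eq_square)
  then have "invertible ?A"
    using invertible_right_inverse by blast
  then have "matrix_inv ?A = matrix_inv ?A ** (?A ** ?B)"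
    by (simp add: AB)
  also have "\<dots> = ?B"
    using \<open>invertible ?A\<close> by (simp add: matrix_mul_assoc matrix_inv_inverse)
  finally show ?thesis .
qed

text \<open>Components in the coframe \<open>dx^1\<close>, \<open>dx^2\<close>, \<omega>. In the
  \<omega>-component all Christoffel terms cancel.\<close>

lemma conn_heis:
  fixes p w :: "real^(3 + 3)"
  defines "u \<equiv> heis_form (base p) (base w)" and "y \<equiv> heis_form (base p) (fibre p)"
  shows "conn heis_metric p w $ 1 = w $ Inr 1 + w $ Inl 2 * y + u * p $ Inr 2"
    and "conn heis_metric p w $ 2 = w $ Inr 2 - u * p $ Inr 1 - w $ Inl 1 * y"
    and "heis_form (base p) (conn heis_metric p w) = w $ Inr 3 + p $ Inl 2 * w $ Inr 1 - p $ Inl 1 * w $ Inr 2"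
  unfolding heis_form_def assms
  by (simp_all add: conn_def sum_3 christoffel_def matrix_inv_heis partial_heis_metric heis_form_def
      base_def fibre_def axis_def algebra_simps power2_eq_square)

section \<open>An orthonormal coframe of the Sasaki metric\<close>

text \<open>The coframe dual to the lifts of \<open>E_1\<close>, \<open>E_2\<close>,
  \<open>E_3\<close>: \<open>Inl\<close> indexes horizontal lifts, \<open>Inr\<close> vertical ones,
  with the formulas of \<open>conn_heis\<close>.\<close>

definition sasaki_coframe :: "3 + 3 \<Rightarrow> (3 + 3) oneform" where
  "sasaki_coframe a p w =
    (let u = w $ Inl 3 + p $ Inl 2 * w $ Inl 1 - p $ Inl 1 * w $ Inl 2;
         y = p $ Inr 3 + p $ Inl 2 * p $ Inr 1 - p $ Inl 1 * p $ Inr 2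
     in case a of
       Inl i \<Rightarrow> vector [w $ Inl 1, w $ Inl 2, u] $ i
     | Inr i \<Rightarrow> vector [w $ Inr 1 + w $ Inl 2 * y + u * p $ Inr 2,
         w $ Inr 2 - u * p $ Inr 1 - w $ Inl 1 * y,
         w $ Inr 3 + p $ Inl 2 * w $ Inr 1 - p $ Inl 1 * w $ Inr 2] $ i)"

text \<open>Here \<open>du\<close> and \<open>dy\<close> are the derivatives of \<open>u\<close> and
  \<open>y\<close> when the point moves along \<open>v\<close> and \<open>w\<close> stays
  fixed.\<close>

definition sasaki_coframe_deriv :: "3 + 3 \<Rightarrow> real^(3 + 3) \<Rightarrow> real^(3 + 3) \<Rightarrow> real^(3 + 3) \<Rightarrow> real" where
  "sasaki_coframe_deriv a p v w =
    (let u = w $ Inl 3 + p $ Inl 2 * w $ Inl 1 - p $ Inl 1 * w $ Inl 2;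
         du = v $ Inl 2 * w $ Inl 1 - v $ Inl 1 * w $ Inl 2;
         dy = v $ Inr 3 + v $ Inl 2 * p $ Inr 1 + p $ Inl 2 * v $ Inr 1
           - v $ Inl 1 * p $ Inr 2 - p $ Inl 1 * v $ Inr 2
     in case a of
       Inl i \<Rightarrow> vector [0, 0, du] $ i
     | Inr i \<Rightarrow> vector [w $ Inl 2 * dy + du * p $ Inr 2 + u * v $ Inr 2,
         - (du * p $ Inr 1) - u * v $ Inr 1 - w $ Inl 1 * dy,
         v $ Inl 2 * w $ Inr 1 - v $ Inl 1 * w $ Inr 2] $ i)"

lemma sasaki_heis_eq_coframe:
  "sasaki heis_metric p v w = (\<Sum>a\<in>UNIV. sasaki_coframe a p v * sasaki_coframe a p w)"
  by (simp add: heis_sasaki_eq heis_metric_def conn_heis sum_3_plus_3 sasaki_coframe_def)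
    (simp add: heis_form_def base_def fibre_def)

lemma linear_sasaki_coframe: "linear (sasaki_coframe a p)"
proof -
  have "\<forall>a. linear (sasaki_coframe a p)"
    unfolding forall_3_plus_3 by (simp add: linear_iff sasaki_coframe_def algebra_simps)
  then show ?thesis ..
qed

lemma bilinear_sasaki_coframe_deriv: "bilinear (sasaki_coframe_deriv a p)"
proof -
  have "\<forall>a. bilinear (sasaki_coframe_deriv a p)"
    unfolding forall_3_plus_3
    by (simp add: bilinear_def linear_iff sasaki_coframe_deriv_def algebra_simps)
  then show ?thesis ..
qed

text \<open>The system is triangular: taken in order, each form determines one further coordinate of
  \<open>w\<close>.\<close>

lemma sasaki_coframe_eq_0:
  assumes "\<And>a. sasaki_coframe a p w = 0"
  shows "w = 0"
proof -
  have "\<forall>a. sasaki_coframe a p w = 0"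
    using assms ..
  then show ?thesis
    unfolding forall_3_plus_3 vec_eq_iff by (auto simp: sasaki_coframe_def Let_def)
qed

lemma sasaki_coframe_has_derivative:
  "((\<lambda>p. sasaki_coframe a p w) has_derivative (\<lambda>v. sasaki_coframe_deriv a p v w)) (at p)"
proof -
  have nth: "((\<lambda>z::real^(3+3). z $ i) has_derivative (\<lambda>w. w $ i)) (at p)" for i
    by (rule bounded_linear_imp_has_derivative) (rule bounded_linear_vec_nth)
  have "\<forall>a. ((\<lambda>p. sasaki_coframe a p w) has_derivative (\<lambda>v. sasaki_coframe_deriv a p v w)) (at p)"
    unfolding forall_3_plus_3 sasaki_coframe_def sasaki_coframe_deriv_def
    by (auto intro!: derivative_eq_intros nth simp: algebra_simps)
  then show ?thesis ..
qed

section \<open>The explicit geodesic\<close>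

abbreviation point :: "real \<Rightarrow> real \<Rightarrow> real \<Rightarrow> real \<Rightarrow> real \<Rightarrow> real \<Rightarrow> real^(3 + 3)" where
  "point x1 x2 x3 y1 y2 y3 \<equiv> (\<chi> i. case i of Inl i \<Rightarrow> vector [x1, x2, x3] $ i | Inr i \<Rightarrow> vector [y1, y2, y3] $ i)"

text \<open>
  The solution of the header in coordinates: a frame component \<open>\<eta>\<close> along \<open>E\<^sub>3\<close> becomes
  \<open>y\<^sup>3 = \<eta> - x\<^sup>2 y\<^sup>1 + x\<^sup>1 y\<^sup>2\<close>.
\<close>

definition twisted_curve :: "real \<Rightarrow> real^(3 + 3)" where
  "twisted_curve t = point t (sin t) (t * sin t + cos t)
     (t * cos t + sin t) (t * (sin t)\<^sup>2 - sin t * cos t) (t\<^sup>2 * (sin t)\<^sup>2 - t * sin t * cos t - 1)"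

definition twisted_curve' :: "real \<Rightarrow> real^(3 + 3)" where
  "twisted_curve' t = point 1 (cos t) (t * cos t)
     (2 * cos t - t * sin t)
     (2 * (sin t)\<^sup>2 - (cos t)\<^sup>2 + 2 * t * sin t * cos t)
     (3 * t * (sin t)\<^sup>2 - t * (cos t)\<^sup>2 + 2 * t\<^sup>2 * sin t * cos t - sin t * cos t)"

definition twisted_curve'' :: "real \<Rightarrow> real^(3 + 3)" where
  "twisted_curve'' t = point 0 (- sin t) (cos t - t * sin t)
     (- 3 * sin t - t * cos t)
     (8 * sin t * cos t + 2 * t * ((cos t)\<^sup>2 - (sin t)\<^sup>2))
     (4 * (sin t)\<^sup>2 - 2 * (cos t)\<^sup>2 + 12 * t * sin t * cos t + 2 * t\<^sup>2 * ((cos t)\<^sup>2 - (sin t)\<^sup>2))"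

lemma has_vector_derivative_twisted_curve: "(twisted_curve has_vector_derivative twisted_curve' t) (at t)"
proof (rule has_vector_derivative_vecI)
  have "\<forall>i. ((\<lambda>t. twisted_curve t $ i) has_real_derivative twisted_curve' t $ i) (at t)"
    unfolding forall_3_plus_3 twisted_curve_def twisted_curve'_def
    by (auto intro!: derivative_eq_intros simp: algebra_simps power2_eq_square)
  then show "((\<lambda>t. twisted_curve t $ i) has_real_derivative twisted_curve' t $ i) (at t)" for i ..
qed

lemma has_vector_derivative_twisted_curve': "(twisted_curve' has_vector_derivative twisted_curve'' t) (at t)"
proof (rule has_vector_derivative_vecI)
  have "\<forall>i. ((\<lambda>t. twisted_curve' t $ i) has_real_derivative twisted_curve'' t $ i) (at t)"
    unfolding forall_3_plus_3 twisted_curve'_def twisted_curve''_def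
    by (auto intro!: derivative_eq_intros simp: algebra_simps power2_eq_square)
  then show "((\<lambda>t. twisted_curve' t $ i) has_real_derivative twisted_curve'' t $ i) (at t)" for i ..
qed

lemma geodesic_twisted_curve: "geodesic (sasaki heis_metric) UNIV twisted_curve"
proof (rule geodesic_coframeI[OF sasaki_heis_eq_coframe linear_sasaki_coframe sasaki_coframe_eq_0
      sasaki_coframe_has_derivative bilinear_sasaki_coframe_deriv _ _
      has_vector_derivative_twisted_curve has_vector_derivative_twisted_curve'])
  fix t l
  let ?p = "twisted_curve t" and ?v = "twisted_curve' t" and ?a = "twisted_curve'' t"
  \<comment> \<open>Given this relation, the six equations are polynomial identities in
    \<open>t\<close>, \<open>sin t\<close> and \<open>cos t\<close>.\<close>
  have "(cos t)\<^sup>2 = 1 - (sin t)\<^sup>2"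
    by (simp add: cos_squared_eq)
  then have "\<forall>l. (\<Sum>a\<in>UNIV.
      (sasaki_coframe a ?p ?a + sasaki_coframe_deriv a ?p ?v ?v) * sasaki_coframe a ?p (axis l 1)
      + sasaki_coframe a ?p ?v
        * (sasaki_coframe_deriv a ?p ?v (axis l 1) - sasaki_coframe_deriv a ?p (axis l 1) ?v)) = 0"
    unfolding forall_3_plus_3 sum_3_plus_3
    by (simp add: sasaki_coframe_def sasaki_coframe_deriv_def twisted_curve_def
        twisted_curve'_def twisted_curve''_def axis_def)
      (intro conjI; algebra)
  then show "(\<Sum>a\<in>UNIV.
      (sasaki_coframe a ?p ?a + sasaki_coframe_deriv a ?p ?v ?v) * sasaki_coframe a ?p (axis l 1)
      + sasaki_coframe a ?p ?v
        * (sasaki_coframe_deriv a ?p ?v (axis l 1) - sasaki_coframe_deriv a ?p (axis l 1) ?v)) = 0" ..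
qed auto

section \<open>The lifted forms along the geodesic\<close>

lemma velocity_twisted_curve: "velocity twisted_curve t = twisted_curve' t"
  unfolding velocity_def using has_vector_derivative_twisted_curve by (rule vector_derivative_at)

lemma hlift_twisted_curve:
  "oneform_hlift heis_metric heis_form (twisted_curve t) (twisted_curve' t) = sin t"
  by (simp add: heis_hlift_eq heis_form_def base_def twisted_curve_def twisted_curve'_def algebra_simps)

lemma vlift_twisted_curve:
  "oneform_vlift heis_metric heis_form (twisted_curve t) (twisted_curve' t) = sin t * cos t"
  by (simp add: heis_vlift_eq conn_heis twisted_curve_def twisted_curve'_def cos_squared_eq)
    (simp add: algebra_simps power2_eq_square)

theorem proposition3p4:
  "\<not> totally_geodesic (sasaki heis_metric) (ker_oneform (oneform_hlift heis_metric heis_form)) \<and>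
   \<not> totally_geodesic (sasaki heis_metric) (ker_oneform (oneform_vlift heis_metric heis_form))"
proof
  \<comment> \<open>At \<open>pi / 4\<close> both \<open>sin t\<close> and
    \<open>sin t * cos t\<close> are nonzero, so one time serves both forms; at
    \<open>pi / 2\<close> the second would vanish.\<close>
  have not_tg: "\<not> totally_geodesic (sasaki heis_metric) (ker_oneform \<alpha>)"
    if "\<alpha> (twisted_curve 0) (twisted_curve' 0) = 0"
      and "\<alpha> (twisted_curve (pi / 4)) (twisted_curve' (pi / 4)) \<noteq> 0" for \<alpha>
    using that geodesic_twisted_curve
    unfolding totally_geodesic_def ker_oneform_def velocity_twisted_curve[symmetric] by blast
  show "\<not> totally_geodesic (sasaki heis_metric) (ker_oneform (oneform_hlift heis_metric heis_form))"
    by (rule not_tg) (simp_all add: hlift_twisted_curve sin_45)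
  show "\<not> totally_geodesic (sasaki heis_metric) (ker_oneform (oneform_vlift heis_metric heis_form))"
    by (rule not_tg) (simp_all add: vlift_twisted_curve sin_45 cos_45)
qed

end
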